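(* Let $p\in(0,1)$ and $S=\{s_i\}$, $i\in\{1,2,\dots,N\}$, $s_i\in\mathbb{R}$, be given, and let $\alpha=\sqrt{\frac{p}{1-p}}$. Consider the likelihood $\mathcal{L}(\mu,\sigma)=\prod_{i=1}^N\psi(s_i;\mu,\sigma,p)$ of the asymmetric normal distribution as a function of $(\mu,\sigma)$, with $p$ fixed. Then the likelihood has a single optimum (maximum), where the optimal partition is given by $$\mu^*=\frac{\alpha^{-2}\sum_{s_i\in S_-}s_i+\alpha^2\sum_{s_i\in S_+}s_i}{\alpha^{-2}|S_-|+\alpha^2|S_+|}$$ and $${\sigma^*}^2=\frac{\alpha^{-2}\sum_{s_i\in S_-}(s_i-\mu^* )^2+\alpha^2\sum_{s_i\in S_+}(s_i-\mu^* )^2}{|S|},$$ where $S_-=\{s_i\in S\mid s_i<\mu^*\}$ and $S_+=\{s_i\in S\mid s_i>\mu^*\}$.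
   Context: For $p\in(0,1)$, $\sigma\in(0,\infty)$, $\mu\in\mathbb{R}$, with $\alpha=\sqrt{\frac{p}{1-p}}$ and $\beta=\frac{2\alpha}{\sigma(\alpha^2+1)}$, the asymmetric normal density is $$\psi(x;\mu,\sigma,p)=\begin{cases}\beta\,\Phi\left(\frac{x-\mu}{\sigma\alpha^{-1}}\right), & x\ge\mu,\\ \beta\,\Phi\left(\frac{x-\mu}{\sigma\alpha}\right), & x<\mu,\end{cases}$$ where $\Phi(\xi)=\frac{1}{\sqrt{2\pi}}\exp\left(-\frac12\xi^2\right)$ is the standard normal density. Samples are counted with multiplicity, $|S|=N$, and $|S_\pm|$ is the number of samples in $S_\pm$. The formula for $\mu^*$ is implicit, since $S_\pm$ depend on $\mu^*$.
   Formalization: The sample S is assumed to contain at least two distinct values; if all s_i are equal (e.g. N=1), the likelihood is unbounded as σ tends to 0 and has no maximum, and if S is empty the likelihood is constant. *)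

theory Defs
  imports "HOL-Probability.Distributions"
begin

definition an_alpha :: "real \<Rightarrow> real" where
  "an_alpha p = sqrt (p / (1 - p))"

definition an_beta :: "real \<Rightarrow> real \<Rightarrow> real" where
  "an_beta \<sigma> p = 2 * an_alpha p / (\<sigma> * ((an_alpha p)\<^sup>2 + 1))"

definition asym_normal_density :: "real \<Rightarrow> real \<Rightarrow> real \<Rightarrow> real \<Rightarrow> real" where
  "asym_normal_density \<mu> \<sigma> p x =
     (if x \<ge> \<mu>
      then an_beta \<sigma> p * std_normal_density ((x - \<mu>) / (\<sigma> * inverse (an_alpha p)))
      else an_beta \<sigma> p * std_normal_density ((x - \<mu>) / (\<sigma> * an_alpha p)))"

(* A sample of size N is the family s 1, ..., s N. Sub-samples are represented by their index
   sets, so that repeated values are counted with multiplicity. *)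

definition asym_normal_likelihood :: "(nat \<Rightarrow> real) \<Rightarrow> nat \<Rightarrow> real \<Rightarrow> real \<times> real \<Rightarrow> real" where
  "asym_normal_likelihood s N p = (\<lambda>(\<mu>, \<sigma>). \<Prod>i\<in>{1..N}. asym_normal_density \<mu> \<sigma> p (s i))"

definition samples_below :: "(nat \<Rightarrow> real) \<Rightarrow> nat \<Rightarrow> real \<Rightarrow> nat set" where
  "samples_below s N \<mu> = {i \<in> {1..N}. s i < \<mu>}"

definition samples_above :: "(nat \<Rightarrow> real) \<Rightarrow> nat \<Rightarrow> real \<Rightarrow> nat set" where
  "samples_above s N \<mu> = {i \<in> {1..N}. s i > \<mu>}"

definition an_params :: "(real \<times> real) set" where
  "an_params = UNIV \<times> {0<..}"

definition local_max_on :: "'a::topological_space set \<Rightarrow> ('a \<Rightarrow> real) \<Rightarrow> 'a \<Rightarrow> bool" where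
  "local_max_on A f x \<longleftrightarrow> x \<in> A \<and> (\<forall>\<^sub>F y in at x within A. f y \<le> f x)"

definition local_min_on :: "'a::topological_space set \<Rightarrow> ('a \<Rightarrow> real) \<Rightarrow> 'a \<Rightarrow> bool" where
  "local_min_on A f x \<longleftrightarrow> x \<in> A \<and> (\<forall>\<^sub>F y in at x within A. f x \<le> f y)"

end

theory Submission
  imports Defs
begin

text \<open>
  Put \<open>a = \<alpha>\<^sup>2\<close> and \<open>b = \<alpha>\<^sup>-\<^sup>2\<close>.  The likelihood is \<open>(k / \<sigma>)^N * exp (- Q \<mu> / (2 * \<sigma>\<^sup>2))\<close> for a constant
  \<open>k > 0\<close>, where \<open>Q \<mu> = \<Sum>i. q (s i - \<mu>)\<close> and \<open>q t\<close> is \<open>a * t\<^sup>2\<close> for \<open>t \<ge> 0\<close> and \<open>b * t\<^sup>2\<close> for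
  \<open>t \<le> 0\<close>.  The function \<open>q\<close> is strictly convex and continuously differentiable, so \<open>Q\<close> has exactly one
  critical point \<open>\<mu>'\<close>, its minimum; it exists by the intermediate value theorem.  For fixed \<open>\<mu>\<close> the only
  critical point in \<open>\<sigma>\<close> is \<open>\<sigma>\<^sup>2 = Q \<mu> / N\<close>, which is the maximum because \<open>x < exp ((x\<^sup>2 - 1) / 2)\<close>
  for \<open>x \<noteq> 1\<close>.
\<close>

section \<open>Fermat's criterion along curves\<close>

text \<open>Composition with \<open>\<gamma>\<close> yields a real function with a local extremum at
  \<open>t\<close>. Applied to the two coordinate lines through a parameter pair, it makes both
  partial derivatives vanish, so no joint derivative is needed.\<close>

lemma local_extremum_deriv_zero:
  fixes f :: "'a::topological_space \<Rightarrow> real" and \<gamma> :: "real \<Rightarrow> 'a"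
  assumes "open A" and ext: "local_max_on A f (\<gamma> t) \<or> local_min_on A f (\<gamma> t)"
    and cont: "isCont \<gamma> t" and deriv: "((\<lambda>u. f (\<gamma> u)) has_real_derivative l) (at t)"
  shows "l = 0"
proof -
  have lim: "filterlim \<gamma> (nhds (\<gamma> t)) (nhds t)"
    using cont by (simp add: isCont_def tendsto_at_iff_tendsto_nhds)
  have A: "\<gamma> t \<in> A"
    using ext by (auto simp: local_max_on_def local_min_on_def)
  note at = at_within_open[OF A \<open>open A\<close>]
  from ext show ?thesis
  proof
    assume "local_max_on A f (\<gamma> t)"
    \<comment> \<open>The unpunctured filter is used because \<open>\<gamma>\<close> may return to
      \<open>\<gamma> t\<close>; at that point the inequality is trivial.\<close>
    then have "\<forall>\<^sub>F y in nhds (\<gamma> t). f y \<le> f (\<gamma> t)"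
      by (simp add: local_max_on_def at eventually_nhds_conv_at)
    then have "\<forall>\<^sub>F u in nhds t. f (\<gamma> u) \<le> f (\<gamma> t)"
      by (rule eventually_compose_filterlim) (rule lim)
    then obtain d where "0 < d" "\<And>u. dist u t < d \<Longrightarrow> f (\<gamma> u) \<le> f (\<gamma> t)"
      by (auto simp: eventually_nhds_metric)
    then show ?thesis
      by (intro DERIV_local_max[OF deriv]) (auto simp: dist_real_def abs_minus_commute)
  next
    assume "local_min_on A f (\<gamma> t)"
    then have "\<forall>\<^sub>F y in nhds (\<gamma> t). f (\<gamma> t) \<le> f y"
      by (simp add: local_min_on_def at eventually_nhds_conv_at)
    then have "\<forall>\<^sub>F u in nhds t. f (\<gamma> t) \<le> f (\<gamma> u)"
      by (rule eventually_compose_filterlim) (rule lim)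
    then obtain d where "0 < d" "\<And>u. dist u t < d \<Longrightarrow> f (\<gamma> t) \<le> f (\<gamma> u)"
      by (auto simp: eventually_nhds_metric)
    then show ?thesis
      by (intro DERIV_local_min[OF deriv]) (auto simp: dist_real_def abs_minus_commute)
  qed
qed

section \<open>The asymmetric square: convexity and derivative\<close>

text \<open>Half the derivative of \<open>asym_square\<close>. With \<open>max\<close> and
  \<open>min\<close> in place of a case split, continuity at 0 is immediate.\<close>

definition asym_slope :: "real \<Rightarrow> real \<Rightarrow> real \<Rightarrow> real" where
  "asym_slope a b t = a * max t 0 + b * min t 0"

definition asym_square :: "real \<Rightarrow> real \<Rightarrow> real \<Rightarrow> real" where
  "asym_square a b t = t * asym_slope a b t"

lemma asym_slope_eq: "asym_slope a b t = (if t \<ge> 0 then a * t else b * t)"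
  by (simp add: asym_slope_def)

lemma asym_square_eq: "asym_square a b t = (if t \<ge> 0 then a * t\<^sup>2 else b * t\<^sup>2)"
  by (simp add: asym_square_def asym_slope_eq power2_eq_square)

lemma isCont_asym_slope: "isCont (asym_slope a b) t"
  unfolding asym_slope_def by (intro continuous_intros)

lemma asym_square_nonneg:
  assumes "0 < a" "0 < b"
  shows "0 \<le> asym_square a b t"
  using assms by (simp add: asym_square_eq)

lemma asym_square_pos:
  assumes "0 < a" "0 < b" "t \<noteq> 0"
  shows "0 < asym_square a b t"
  using assms by (simp add: asym_square_eq)

text \<open>Strict convexity. On one side of 0 the gap is \<open>c * (u - t)\<^sup>2\<close> with
  \<open>c\<close> the weight there. Across 0 it is a sum of two squares and a mixed term, none
  negative and the square of the negative argument positive.\<close>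

lemma asym_square_above_tangent:
  assumes ab: "0 < a" "0 < b" and "u \<noteq> t"
  shows "asym_square a b t + 2 * asym_slope a b t * (u - t) < asym_square a b u"
proof -
  have sq: "0 < c * (u - t)\<^sup>2" if "0 < c" for c :: real
    using that \<open>u \<noteq> t\<close> by simp
  consider "t \<ge> 0" "u \<ge> 0" | "t < 0" "u < 0" | "t \<ge> 0" "u < 0" | "t < 0" "u \<ge> 0"
    by linarith
  then show ?thesis
  proof cases
    case 1
    with sq[OF ab(1)] show ?thesis
      by (simp add: asym_slope_eq asym_square_eq power2_eq_square algebra_simps)
  next
    case 2
    with sq[OF ab(2)] show ?thesis
      by (simp add: asym_slope_eq asym_square_eq power2_eq_square algebra_simps)
  next
    case 3
    have "0 < b * u\<^sup>2" "0 \<le> a * t\<^sup>2" "a * (t * u) \<le> 0"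
      using 3 ab by (auto simp: mult_le_0_iff)
    with 3 show ?thesis
      by (simp add: asym_slope_eq asym_square_eq power2_eq_square algebra_simps)
  next
    case 4
    have "0 \<le> a * u\<^sup>2" "0 < b * t\<^sup>2" "b * (t * u) \<le> 0"
      using 4 ab by (auto simp: mult_le_0_iff)
    with 4 show ?thesis
      by (simp add: asym_slope_eq asym_square_eq power2_eq_square algebra_simps)
  qed
qed

lemma DERIV_asym_square: "(asym_square a b has_real_derivative 2 * asym_slope a b t) (at t)"
proof -
  have quad: "((\<lambda>t. c * t\<^sup>2) has_real_derivative 2 * (c * t)) (at t)" for c :: real
    by (auto intro!: derivative_eq_intros)
  consider "t > 0" | "t < 0" | "t = 0"
    by linarith
  then show ?thesis
  proof cases
    case 1
    then have "(asym_square a b has_real_derivative 2 * (a * t)) (at t)"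
      by (intro has_field_derivative_transform_within_open[OF quad, of "{0<..}"])
        (auto simp: asym_square_eq)
    with 1 show ?thesis
      by (simp add: asym_slope_eq)
  next
    case 2
    then have "(asym_square a b has_real_derivative 2 * (b * t)) (at t)"
      by (intro has_field_derivative_transform_within_open[OF quad, of "{..<0}"])
        (auto simp: asym_square_eq)
    with 2 show ?thesis
      by (simp add: asym_slope_eq)
  next
    case 3
    \<comment> \<open>At the kink the slope is itself the difference quotient, so Caratheodory's
      criterion applies; its value at 0 is 0, so the factor 2 makes no difference.\<close>
    have "(asym_square a b has_real_derivative asym_slope a b 0) (at 0)"
      unfolding CARAT_DERIV
      by (rule exI[of _ "asym_slope a b"])
        (use isCont_asym_slope in \<open>auto simp: asym_square_def\<close>)
    then show ?thesis
      using 3 by (simp add: asym_slope_eq)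
  qed
qed

section \<open>Sums over the sample and the critical location\<close>

lemma sum_asym_slope_root:
  assumes fin: "finite I" and ne: "I \<noteq> {}" and ab: "0 < a" "0 < b"
  obtains m where "(\<Sum>i\<in>I. asym_slope a b (s i - m)) = 0"
proof -
  let ?D = "\<lambda>m. \<Sum>i\<in>I. asym_slope a b (s i - m)"
  let ?l = "Min (s ` I)" and ?h = "Max (s ` I)"
  have bounds: "?l \<le> s i" "s i \<le> ?h" if "i \<in> I" for i
    using fin that by auto
  \<comment> \<open>At the largest sample no deviation is positive, at the smallest none is
    negative; this gives the sign change.\<close>
  have "?D ?h \<le> 0"
    using bounds ab by (intro sum_nonpos) (auto simp: asym_slope_def mult_le_0_iff)
  moreover have "0 \<le> ?D ?l"
    using bounds ab by (intro sum_nonneg) (auto simp: asym_slope_def)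
  moreover have "?l \<le> ?h"
    using bounds ne by (meson equals0I order_trans)
  moreover have "continuous_on {?l..?h} ?D"
    unfolding asym_slope_def by (intro continuous_intros)
  ultimately show ?thesis
    using IVT2'[of ?D ?h 0 ?l] that by auto
qed

text \<open>Sum the tangent inequalities at the points \<open>s i - m\<close>: every step has length
  \<open>m - x\<close>, so the linear terms add up to a multiple of the slope sum, which is
  0.\<close>

lemma sum_asym_square_less:
  assumes fin: "finite I" and ne: "I \<noteq> {}" and ab: "0 < a" "0 < b"
    and root: "(\<Sum>i\<in>I. asym_slope a b (s i - m)) = 0" and "x \<noteq> m"
  shows "(\<Sum>i\<in>I. asym_square a b (s i - m)) < (\<Sum>i\<in>I. asym_square a b (s i - x))"
proof -
  have "(\<Sum>i\<in>I. asym_square a b (s i - m))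
      = (\<Sum>i\<in>I. asym_square a b (s i - m)) + 2 * (\<Sum>i\<in>I. asym_slope a b (s i - m)) * (m - x)"
    using root by simp
  also have "\<dots> = (\<Sum>i\<in>I. asym_square a b (s i - m)
      + 2 * asym_slope a b (s i - m) * ((s i - x) - (s i - m)))"
    by (simp add: sum.distrib sum_distrib_left sum_distrib_right)
  also have "\<dots> < (\<Sum>i\<in>I. asym_square a b (s i - x))"
    using \<open>x \<noteq> m\<close> by (intro sum_strict_mono[OF fin ne] asym_square_above_tangent[OF ab]) auto
  finally show ?thesis .
qed

lemma DERIV_sum_asym_square:
  "((\<lambda>m. \<Sum>i\<in>I. asym_square a b (s i - m)) has_real_derivative
     - 2 * (\<Sum>i\<in>I. asym_slope a b (s i - m))) (at m)"
proof -
  have "((\<lambda>m. asym_square a b (s i - m)) has_real_derivative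
      2 * asym_slope a b (s i - m) * (- 1)) (at m)" for i
    by (rule DERIV_chain2[OF DERIV_asym_square]) (auto intro!: derivative_eq_intros)
  then show ?thesis
    unfolding sum_distrib_left by (intro DERIV_sum) (simp add: mult.commute)
qed

text \<open>Samples equal to \<open>m\<close> fall into the first branch but contribute
  \<open>a * f 0 = 0\<close>, so both index sets can be strict. The identity for \<open>f\<close>
  gives the location formula, the square the scale formula.\<close>

lemma sum_asym_split:
  fixes f :: "real \<Rightarrow> real"
  assumes "f 0 = 0"
  shows "(\<Sum>i\<in>{1..N}. if s i - m \<ge> 0 then a * f (s i - m) else b * f (s i - m))
    = b * (\<Sum>i\<in>samples_below s N m. f (s i - m)) + a * (\<Sum>i\<in>samples_above s N m. f (s i - m))"
proof -
  have "(\<Sum>i\<in>{1..N}. if s i - m \<ge> 0 then a * f (s i - m) else b * f (s i - m))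
      = (\<Sum>i\<in>{1..N}. (if s i < m then b * f (s i - m) else 0)
          + (if s i > m then a * f (s i - m) else 0))"
    using assms by (intro sum.cong) auto
  also have "\<dots> = (\<Sum>i\<in>samples_below s N m. b * f (s i - m))
      + (\<Sum>i\<in>samples_above s N m. a * f (s i - m))"
    by (simp only: sum.distrib samples_below_def samples_above_def sum.inter_filter
        finite_atLeastAtMost)
  finally show ?thesis
    by (simp add: sum_distrib_left)
qed

text \<open>The split slope sum is linear in \<open>m\<close> once the index sets are held fixed;
  solve it for \<open>m\<close>. A sample different from \<open>m\<close> makes the denominator
  positive.\<close>

lemma root_eq_weighted_mean:
  assumes ab: "0 < a" "0 < b" and root: "(\<Sum>i\<in>{1..N}. asym_slope a b (s i - m)) = 0"
    and "\<exists>i\<in>{1..N}. s i \<noteq> m"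
  shows "m = (b * (\<Sum>i\<in>samples_below s N m. s i) + a * (\<Sum>i\<in>samples_above s N m. s i))
    / (b * real (card (samples_below s N m)) + a * real (card (samples_above s N m)))"
proof -
  have fin: "finite (samples_below s N m)" "finite (samples_above s N m)"
    by (auto simp: samples_below_def samples_above_def)
  have "samples_below s N m \<noteq> {} \<or> samples_above s N m \<noteq> {}"
    using assms(4) by (auto simp: samples_below_def samples_above_def neq_iff)
  then have "0 < card (samples_below s N m) \<or> 0 < card (samples_above s N m)"
    using fin by (simp add: card_gt_0_iff)
  then have "b * real (card (samples_below s N m)) + a * real (card (samples_above s N m)) > 0"
    using ab by (auto intro: add_pos_nonneg add_nonneg_pos)
  moreover have "b * (\<Sum>i\<in>samples_below s N m. s i - m) + a * (\<Sum>i\<in>samples_above s N m. s i - m) = 0"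
    using root sum_asym_split[of "\<lambda>t. t" s m a b N] by (simp add: asym_slope_eq)
  ultimately show ?thesis
    by (simp add: sum_subtractf field_simps)
qed

section \<open>The likelihood in closed form\<close>

text \<open>Squaring the scaled argument turns \<open>\<sigma> / \<alpha>\<close> into the weight
  \<open>\<alpha>\<^sup>2\<close> above \<open>\<mu>\<close> and \<open>\<sigma> * \<alpha>\<close>
  into its inverse below. At \<open>\<sigma> = 0\<close> both sides are 0, since division by 0 gives
  0.\<close>

lemma asym_normal_density_eq:
  assumes "0 < an_alpha p"
  shows "asym_normal_density \<mu> \<sigma> p x =
    2 * an_alpha p / (((an_alpha p)\<^sup>2 + 1) * sqrt (2 * pi)) / \<sigma>
      * exp (- asym_square ((an_alpha p)\<^sup>2) (inverse ((an_alpha p)\<^sup>2)) (x - \<mu>) / (2 * \<sigma>\<^sup>2))"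
  using assms
  by (auto simp: asym_normal_density_def an_beta_def normal_density_def asym_square_eq
      divide_simps)

lemma asym_normal_likelihood_eq:
  assumes "0 < an_alpha p"
  shows "asym_normal_likelihood s N p (\<mu>, \<sigma>) =
    (2 * an_alpha p / (((an_alpha p)\<^sup>2 + 1) * sqrt (2 * pi)) / \<sigma>) ^ N
      * exp (- (\<Sum>i\<in>{1..N}. asym_square ((an_alpha p)\<^sup>2) (inverse ((an_alpha p)\<^sup>2)) (s i - \<mu>))
          / (2 * \<sigma>\<^sup>2))"
proof -
  have "(\<Prod>i\<in>{1..N}. c * exp (- q i / d)) = c ^ N * exp (- (\<Sum>i\<in>{1..N}. q i) / d)"
    for c d :: real and q :: "nat \<Rightarrow> real"
    by (simp add: prod.distrib sum_divide_distrib exp_sum flip: sum_negf)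
  then show ?thesis
    by (simp only: asym_normal_likelihood_def asym_normal_density_eq[OF assms] split)
qed

section \<open>The optimal scale at a fixed location\<close>

lemma less_exp_half_square:
  fixes x :: real
  assumes "x \<noteq> 1"
  shows "x < exp ((x\<^sup>2 - 1) / 2)"
proof -
  have "0 < (x - 1)\<^sup>2"
    using assms by simp
  then have "x < 1 + (x\<^sup>2 - 1) / 2"
    by (simp add: power2_eq_square field_simps)
  also have "\<dots> \<le> exp ((x\<^sup>2 - 1) / 2)"
    by (rule exp_ge_add_one_self)
  finally show ?thesis .
qed

text \<open>Both sides are \<open>N\<close>-th powers, and comparing their bases amounts to
  \<open>less_exp_half_square\<close> at the ratio \<open>\<tau> / \<sigma>\<close>.\<close>

lemma scale_likelihood_less:
  fixes k \<sigma> \<tau> :: real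
  assumes "0 < k" "0 < \<sigma>" "0 < \<tau>" "\<sigma> \<noteq> \<tau>" "0 < N"
  shows "(k / \<sigma>) ^ N * exp (- (real N * \<tau>\<^sup>2) / (2 * \<sigma>\<^sup>2))
    < (k / \<tau>) ^ N * exp (- (real N * \<tau>\<^sup>2) / (2 * \<tau>\<^sup>2))"
proof -
  have pow: "(k / x) ^ N * exp (- (real N * \<tau>\<^sup>2) / (2 * x\<^sup>2)) = (k / x * exp (- (\<tau>\<^sup>2 / (2 * x\<^sup>2)))) ^ N"
    for x :: real
    by (simp add: power_mult_distrib power_divide flip: exp_of_nat_mult)
  have "\<tau> / \<sigma> < exp (((\<tau> / \<sigma>)\<^sup>2 - 1) / 2)"
    using assms by (intro less_exp_half_square) auto
  also have "\<dots> = exp (\<tau>\<^sup>2 / (2 * \<sigma>\<^sup>2)) * exp (- (1 / 2))"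
    unfolding exp_add[symmetric] by (simp add: power_divide diff_divide_distrib)
  finally have "1 / \<sigma> * exp (- (\<tau>\<^sup>2 / (2 * \<sigma>\<^sup>2))) < 1 / \<tau> * exp (- (1 / 2))"
    using assms by (simp add: exp_minus field_simps)
  then have "k * (1 / \<sigma> * exp (- (\<tau>\<^sup>2 / (2 * \<sigma>\<^sup>2)))) < k * (1 / \<tau> * exp (- (1 / 2)))"
    using assms by (intro mult_strict_left_mono)
  then have "k / \<sigma> * exp (- (\<tau>\<^sup>2 / (2 * \<sigma>\<^sup>2))) < k / \<tau> * exp (- (\<tau>\<^sup>2 / (2 * \<tau>\<^sup>2)))"
    using assms by simp
  then show ?thesis
    unfolding pow using assms by (intro power_strict_mono) auto
qed

text \<open>The derivative is written as value times logarithmic derivative, so that for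
  \<open>k \<noteq> 0\<close> its vanishing reads \<open>\<sigma>\<^sup>2 = c / N\<close>.\<close>

lemma DERIV_scale_likelihood:
  fixes k \<sigma> c :: real
  assumes "0 < \<sigma>" "0 < N"
  shows "((\<lambda>\<sigma>. (k / \<sigma>) ^ N * exp (- c / (2 * \<sigma>\<^sup>2))) has_real_derivative
    (k / \<sigma>) ^ N * exp (- c / (2 * \<sigma>\<^sup>2)) * ((c / \<sigma>\<^sup>2 - real N) / \<sigma>)) (at \<sigma>)"
proof -
  obtain n where N: "N = Suc n"
    using assms by (cases N) auto
  have "((\<lambda>\<sigma>. k / \<sigma>) has_real_derivative - (k / \<sigma>\<^sup>2)) (at \<sigma>)"
    using assms by (auto intro!: derivative_eq_intros simp: power2_eq_square)
  note pow = DERIV_power_Suc[OF this, of n]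
  have exp: "((\<lambda>\<sigma>. exp (- c / (2 * \<sigma>\<^sup>2))) has_real_derivative
      exp (- c / (2 * \<sigma>\<^sup>2)) * (c / \<sigma> ^ 3)) (at \<sigma>)"
    using assms
    by (auto intro!: derivative_eq_intros simp: power2_eq_square power3_eq_cube field_simps)
  show ?thesis
    unfolding N
    by (rule DERIV_cong[OF DERIV_mult[OF pow exp]])
      (use assms in \<open>simp add: power2_eq_square power3_eq_cube field_simps\<close>)
qed

section \<open>Existence, uniqueness and form of the optimum\<close>

theorem theorem10:
  fixes p :: real and N :: nat and s :: "nat \<Rightarrow> real"
  assumes p: "0 < p" "p < 1"
    and nonconst: "\<exists>i\<in>{1..N}. \<exists>j\<in>{1..N}. s i \<noteq> s j"
  shows "\<exists>\<mu>' \<sigma>'.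
    {\<theta>. is_arg_max (asym_normal_likelihood s N p) (\<lambda>\<theta>. \<theta> \<in> an_params) \<theta>} = {(\<mu>', \<sigma>')} \<and>
    {\<theta>. local_max_on an_params (asym_normal_likelihood s N p) \<theta> \<or>
         local_min_on an_params (asym_normal_likelihood s N p) \<theta>} = {(\<mu>', \<sigma>')} \<and>
    (let \<alpha> = an_alpha p; Sm = samples_below s N \<mu>'; Sp = samples_above s N \<mu>' in
      \<mu>' = (\<alpha> powi (-2) * (\<Sum>i\<in>Sm. s i) + \<alpha>\<^sup>2 * (\<Sum>i\<in>Sp. s i))
             / (\<alpha> powi (-2) * real (card Sm) + \<alpha>\<^sup>2 * real (card Sp)) \<and>
      \<sigma>'\<^sup>2 = (\<alpha> powi (-2) * (\<Sum>i\<in>Sm. (s i - \<mu>')\<^sup>2) + \<alpha>\<^sup>2 * (\<Sum>i\<in>Sp. (s i - \<mu>')\<^sup>2))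
             / real N)"
proof -
  define a where "a = (an_alpha p)\<^sup>2"
  define b where "b = inverse a"
  define k where "k = 2 * an_alpha p / (((an_alpha p)\<^sup>2 + 1) * sqrt (2 * pi))"
  define D where "D \<mu> = (\<Sum>i\<in>{1..N}. asym_slope a b (s i - \<mu>))" for \<mu>
  define Q where "Q \<mu> = (\<Sum>i\<in>{1..N}. asym_square a b (s i - \<mu>))" for \<mu>
  let ?L = "asym_normal_likelihood s N p"
  have \<alpha>: "0 < an_alpha p"
    using p by (simp add: an_alpha_def)
  then have ab: "0 < a" "0 < b" and k: "0 < k"
    by (auto simp: a_def b_def k_def intro!: divide_pos_pos mult_pos_pos add_pos_pos)
  have N: "0 < N" and I: "{1..N} \<noteq> {}"
    using nonconst by auto
  have L: "?L (\<mu>, \<sigma>) = (k / \<sigma>) ^ N * exp (- Q \<mu> / (2 * \<sigma>\<^sup>2))" for \<mu> \<sigma>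
    using asym_normal_likelihood_eq[OF \<alpha>] by (simp add: Q_def a_def b_def k_def)
  \<comment> \<open>Two distinct sample values cannot both equal \<open>\<mu>\<close>. For a
    constant sample, \<open>Q\<close> would vanish at the common value and the likelihood would be
    unbounded as \<open>\<sigma>\<close> tends to 0.\<close>
  have Q_pos: "0 < Q \<mu>" for \<mu>
  proof -
    obtain i where "i \<in> {1..N}" "s i \<noteq> \<mu>"
      using nonconst by metis
    then show ?thesis
      unfolding Q_def
      by (intro sum_pos2[of _ i]) (auto intro: asym_square_pos asym_square_nonneg ab)
  qed
  obtain m where m: "D m = 0"
    unfolding D_def using sum_asym_slope_root[OF _ I ab] by blast
  have Q_less: "Q x < Q y" if "D x = 0" "y \<noteq> x" for x y
    using sum_asym_square_less[OF _ I ab] that unfolding Q_def D_def by blast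
  define \<tau> where "\<tau> = sqrt (Q m / N)"
  have \<tau>: "0 < \<tau>" and \<tau>2: "\<tau>\<^sup>2 = Q m / N" and Qm: "Q m = real N * \<tau>\<^sup>2"
    using Q_pos[of m] N by (auto simp: \<tau>_def)

  \<comment> \<open>Move the location to \<open>m\<close> at fixed scale, then the scale to
    \<open>\<tau>\<close>; each move that changes something strictly increases the
    likelihood.\<close>
  have best: "?L \<theta> < ?L (m, \<tau>)" if \<theta>_in: "\<theta> \<in> an_params" and \<theta>_ne: "\<theta> \<noteq> (m, \<tau>)" for \<theta>
  proof -
    obtain \<mu> \<sigma> where \<theta>: "\<theta> = (\<mu>, \<sigma>)" and \<sigma>: "0 < \<sigma>"
      using \<theta>_in by (auto simp: an_params_def)
    have 1: "?L (\<mu>, \<sigma>) < ?L (m, \<sigma>)" if "\<mu> \<noteq> m"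
      using Q_less[OF m that] k \<sigma> by (simp add: L divide_strict_right_mono)
    have 2: "?L (m, \<sigma>) < ?L (m, \<tau>)" if "\<sigma> \<noteq> \<tau>"
      unfolding L Qm using k \<sigma> \<tau> that N by (rule scale_likelihood_less)
    show ?thesis
      using 1 2 \<theta>_ne unfolding \<theta> by fastforce
  qed
  then have best_le: "?L \<theta> \<le> ?L (m, \<tau>)" if "\<theta> \<in> an_params" for \<theta>
    using that less_eq_real_def by blast
  have opt: "(m, \<tau>) \<in> an_params"
    using \<tau> by (simp add: an_params_def)
  have "open an_params"
    by (simp add: an_params_def open_Times)

  \<comment> \<open>Maxima and minima are treated alike: only the vanishing of the partial
    derivatives is used, first in \<open>\<sigma>\<close>, then in \<open>\<mu>\<close>.\<close>
  have critical: "\<theta> = (m, \<tau>)" if ext: "local_max_on an_params ?L \<theta> \<or> local_min_on an_params ?L \<theta>" for \<theta>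
  proof -
    obtain \<mu> \<sigma> where \<theta>: "\<theta> = (\<mu>, \<sigma>)" and \<sigma>: "0 < \<sigma>"
      using ext by (auto simp: local_max_on_def local_min_on_def an_params_def)
    have "((\<lambda>\<sigma>. ?L (\<mu>, \<sigma>)) has_real_derivative
        (k / \<sigma>) ^ N * exp (- Q \<mu> / (2 * \<sigma>\<^sup>2)) * ((Q \<mu> / \<sigma>\<^sup>2 - real N) / \<sigma>)) (at \<sigma>)"
      unfolding L by (rule DERIV_scale_likelihood[OF \<sigma> N])
    then have "(k / \<sigma>) ^ N * exp (- Q \<mu> / (2 * \<sigma>\<^sup>2)) * ((Q \<mu> / \<sigma>\<^sup>2 - real N) / \<sigma>) = 0"
      using ext unfolding \<theta>
      by (intro local_extremum_deriv_zero[OF \<open>open an_params\<close>, where \<gamma> = "\<lambda>\<sigma>. (\<mu>, \<sigma>)"])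
        (auto intro!: isCont_Pair continuous_const continuous_ident)
    then have scale: "\<sigma>\<^sup>2 = Q \<mu> / N"
      using k \<sigma> N by (simp add: field_simps)
    have "(Q has_real_derivative - 2 * D \<mu>) (at \<mu>)"
      unfolding Q_def[abs_def] D_def by (rule DERIV_sum_asym_square)
    then have "((\<lambda>\<mu>. ?L (\<mu>, \<sigma>)) has_real_derivative
        (k / \<sigma>) ^ N * (exp (- Q \<mu> / (2 * \<sigma>\<^sup>2)) * (D \<mu> / \<sigma>\<^sup>2))) (at \<mu>)"
      unfolding L using \<sigma> by (auto intro!: derivative_eq_intros simp: field_simps)
    then have "(k / \<sigma>) ^ N * (exp (- Q \<mu> / (2 * \<sigma>\<^sup>2)) * (D \<mu> / \<sigma>\<^sup>2)) = 0"
      using ext unfolding \<theta>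
      by (intro local_extremum_deriv_zero[OF \<open>open an_params\<close>, where \<gamma> = "\<lambda>\<mu>. (\<mu>, \<sigma>)"])
        (auto intro!: isCont_Pair continuous_const continuous_ident)
    then have "D \<mu> = 0"
      using k \<sigma> by simp
    \<comment> \<open>Two distinct zeros of \<open>D\<close> would each give \<open>Q\<close> a
      strictly smaller value than the other.\<close>
    then have "\<mu> = m"
      using Q_less[of \<mu> m] Q_less[OF m, of \<mu>] by (cases "\<mu> = m") auto
    moreover from this have "\<sigma> = \<tau>"
      using scale \<sigma> by (simp add: \<tau>_def real_sqrt_unique)
    ultimately show ?thesis
      by (simp add: \<theta>)
  qed

  have "{\<theta>. is_arg_max ?L (\<lambda>\<theta>. \<theta> \<in> an_params) \<theta>} = {(m, \<tau>)}"
  proof (intro set_eqI iffI)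
    fix \<theta>
    assume "\<theta> \<in> {\<theta>. is_arg_max ?L (\<lambda>\<theta>. \<theta> \<in> an_params) \<theta>}"
    then have "\<theta> \<in> an_params" "\<not> ?L \<theta> < ?L (m, \<tau>)"
      using opt by (simp_all add: is_arg_max_def)
    then show "\<theta> \<in> {(m, \<tau>)}"
      using best[of \<theta>] by blast
  next
    fix \<theta>
    assume "\<theta> \<in> {(m, \<tau>)}"
    then show "\<theta> \<in> {\<theta>. is_arg_max ?L (\<lambda>\<theta>. \<theta> \<in> an_params) \<theta>}"
      using opt best_le by (simp add: is_arg_max_def not_less)
  qed
  \<comment> \<open>The global maximum is also a local one, so the set of local extrema is not
    empty.\<close>
  moreover have "local_max_on an_params ?L (m, \<tau>)"
    unfolding local_max_on_def eventually_at_filter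
    using opt best_le by (simp add: always_eventually)
  then have "{\<theta>. local_max_on an_params ?L \<theta> \<or> local_min_on an_params ?L \<theta>} = {(m, \<tau>)}"
    using critical by auto
  moreover have "m = (b * (\<Sum>i\<in>samples_below s N m. s i) + a * (\<Sum>i\<in>samples_above s N m. s i))
      / (b * real (card (samples_below s N m)) + a * real (card (samples_above s N m)))"
    using m nonconst unfolding D_def by (intro root_eq_weighted_mean[OF ab]) metis+
  moreover have "Q m = b * (\<Sum>i\<in>samples_below s N m. (s i - m)\<^sup>2)
      + a * (\<Sum>i\<in>samples_above s N m. (s i - m)\<^sup>2)"
    using sum_asym_split[of "\<lambda>t. t\<^sup>2" s m a b N] by (simp add: Q_def asym_square_eq)
  moreover have "an_alpha p powi (-2) = b"
    by (simp add: a_def b_def power_int_minus)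
  ultimately show ?thesis
    unfolding Let_def using \<tau>2
    by (intro exI[of _ m] exI[of _ \<tau>]) (simp flip: a_def)
qed

end
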